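(* Let $a\in\mathbb{R}$, $K\in\mathbb{N}$, and let $x:\mathbb{N}_{a-K-1}\to\mathbb{R}$ and $w:\mathbb{N}_{a-K-1}\to\mathbb{R}\setminus\{0\}$. Then for every $k\in\mathbb{N}_{a+1}$ the following hold. (1) If $n\in\mathbb{Z}_+$ and $K>n$, then $$\nabla^{n,w(k)}x(k)=\sum_{i=n}^{K}\frac{(k-a)^{\overline{i-n}}}{(i-n)!}\frac{w(a)}{w(k)}\bigl[\nabla^{i,w(k)}x(k)\bigr]_{k=a}+\sum_{j=a+1}^{k}\frac{(k-j+1)^{\overline{K-n}}}{(K-n)!}\frac{w(j)}{w(k)}\nabla^{K+1,w(j)}x(j).$$ (2) If $\alpha\in\mathbb{R}\setminus\mathbb{Z}_+$, then $${}_a^{\rm G}\nabla_k^{\alpha,w(k)}x(k)=\sum_{i=0}^{K}\frac{(k-a)^{\overline{i-\alpha}}}{\Gamma(i-\alpha+1)}\frac{w(a)}{w(k)}\bigl[\nabla^{i,w(k)}x(k)\bigr]_{k=a}+\sum_{j=a+1}^{k}\frac{(k-j+1)^{\overline{K-\alpha}}}{\Gamma(K-\alpha+1)}\frac{w(j)}{w(k)}\nabla^{K+1,w(j)}x(j).$$ (3) If $n\in\mathbb{Z}_+$ and $\alpha\in(n-1,n)$, then $${}_a^{\rm R}\nabla_k^{\alpha,w(k)}x(k)=\sum_{i=0}^{K}\frac{(k-a)^{\overline{i-\alpha}}}{\Gamma(i-\alpha+1)}\frac{w(a)}{w(k)}\bigl[\nabla^{i,w(k)}x(k)\bigr]_{k=a}+\sum_{j=a+1}^{k}\frac{(k-j+1)^{\overline{K-\alpha}}}{\Gamma(K-\alpha+1)}\frac{w(j)}{w(k)}\nabla^{K+1,w(j)}x(j).$$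 (4) If $n\in\mathbb{Z}_+$, $\alpha\in(n-1,n)$ and $K>n$, then $${}_a^{\rm C}\nabla_k^{\alpha,w(k)}x(k)=\sum_{i=n}^{K}\frac{(k-a)^{\overline{i-\alpha}}}{\Gamma(i-\alpha+1)}\frac{w(a)}{w(k)}\bigl[\nabla^{i,w(k)}x(k)\bigr]_{k=a}+\sum_{j=a+1}^{k}\frac{(k-j+1)^{\overline{K-\alpha}}}{\Gamma(K-\alpha+1)}\frac{w(j)}{w(k)}\nabla^{K+1,w(j)}x(j).$$
   Context: For $b\in\mathbb{R}$, $\mathbb{N}_b=\{b,b+1,b+2,\dots\}$; $\mathbb{N}=\{0,1,2,\dots\}$, $\mathbb{Z}_+=\{1,2,\dots\}$. $p^{\overline{q}}=\Gamma(p+q)/\Gamma(p)$ is the rising function. $\binom{p}{i}=\frac{p(p-1)\cdots(p-i+1)}{i!}$ for real $p$ and integer $i\ge 0$. Nabla difference: $\nabla^n z(k)=\sum_{i=0}^n(-1)^i\binom{n}{i}z(k-i)$, with $\nabla^0 z=z$. Grünwald–Letnikov difference/sum of order $\alpha\in\mathbb{R}$: ${}_a^{\rm G}\nabla_k^\alpha z(k)=\sum_{i=0}^{k-a-1}(-1)^i\binom{\alpha}{i}z(k-i)$; empty sums are $0$, so this equals $0$ at $k=a,a-1,\dots$. For $\alpha\in(n-1,n)$, Riemann–Liouville: ${}_a^{\rm R}\nabla_k^\alpha z(k)=\nabla^n\,{}_a^{\rm G}\nabla_k^{\alpha-n}z(k)$; Caputo: ${}_a^{\rm C}\nabla_k^\alpha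 z(k)={}_a^{\rm G}\nabla_k^{\alpha-n}\nabla^n z(k)$. Tempered versions, with tempered function $w$ (nowhere zero): for each of the operators $D$ among $\nabla^n$, ${}_a^{\rm G}\nabla_k^\alpha$, ${}_a^{\rm R}\nabla_k^\alpha$, ${}_a^{\rm C}\nabla_k^\alpha$ the tempered operator (written with the extra superscript $w(k)$) sends $x$ to $w^{-1}(k)\,D[w(k)x(k)]$, where $w^{-1}(k)=1/w(k)$. $[\,\cdot\,]_{k=a}$ denotes evaluation at $k=a$, and $\nabla^{K+1,w(j)}x(j)$ is the tempered difference evaluated at $j$. *)

theory Defs
  imports "HOL-Analysis.Analysis"
begin

definition nats_from :: "real \<Rightarrow> real set" where
  "nats_from b = (\<lambda>m::nat. b + real m) ` UNIV"

text \<open>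
  The library's Gamma function takes the value 0 at its poles, so the quotient below has its
  usual meaning only if neither \<open>p\<close> nor \<open>p + q\<close> is a nonpositive integer.
\<close>

definition rising :: "real \<Rightarrow> real \<Rightarrow> real" where
  "rising p q = Gamma (p + q) / Gamma p"

text \<open>
  A function on the points \<open>b, b + 1, \<dots>\<close> is represented by a total function on the reals
  whose values elsewhere are irrelevant.
\<close>

definition nabla :: "nat \<Rightarrow> (real \<Rightarrow> real) \<Rightarrow> real \<Rightarrow> real" where
  "nabla n z k = (\<Sum>i=0..n. (-1) ^ i * real (n choose i) * z (k - real i))"

text \<open>
  The index set \<open>0 \<le> i \<le> k - a - 1\<close> is always finite, and it is empty if \<open>k \<le> a\<close>.
\<close>

definition gl_nabla :: "real \<Rightarrow> real \<Rightarrow> (real \<Rightarrow> real) \<Rightarrow> real \<Rightarrow> real" where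
  "gl_nabla a \<alpha> z k =
     (\<Sum>i | real i \<le> k - a - 1. (-1) ^ i * (\<alpha> gchoose i) * z (k - real i))"

text \<open>
  The order \<open>n\<close> of the integer difference is an explicit argument of the next two operators;
  they are meant for \<open>n - 1 < \<alpha> < n\<close>, which determines \<open>n\<close>.
\<close>

definition rl_nabla :: "nat \<Rightarrow> real \<Rightarrow> real \<Rightarrow> (real \<Rightarrow> real) \<Rightarrow> real \<Rightarrow> real" where
  "rl_nabla n a \<alpha> z = nabla n (gl_nabla a (\<alpha> - real n) z)"

definition caputo_nabla :: "nat \<Rightarrow> real \<Rightarrow> real \<Rightarrow> (real \<Rightarrow> real) \<Rightarrow> real \<Rightarrow> real" where
  "caputo_nabla n a \<alpha> z = gl_nabla a (\<alpha> - real n) (nabla n z)"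

definition tempered ::
  "((real \<Rightarrow> real) \<Rightarrow> real \<Rightarrow> real) \<Rightarrow> (real \<Rightarrow> real) \<Rightarrow> (real \<Rightarrow> real) \<Rightarrow> real \<Rightarrow> real" where
  "tempered D w x k = (1 / w k) * D (\<lambda>s. w s * x s) k"

end

(*
  The weight w only enters through f = w x, so everything reduces to untempered identities for f.
  With c(q, m) = (q+1)(q+2)...(q+m) / m!, the difference of order alpha at a + 1 + m is the
  convolution of c(- alpha - 1, .) with the values of f. Since c(q + 1, .) has backward
  difference c(q, .), summation by parts turns this into a boundary term at a plus the
  convolution of c(- alpha, .) with the values of the difference of f; K + 1 summations by parts
  give (2). The other parts follow from the composition rules for the differences: (3) because
  the Riemann-Liouville and Gruenwald-Letnikov differences coincide, (1) and (4) by applying (2)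
  to the n-th difference of f, with K - n in place of K and order 0 or alpha - n.
*)
theory Submission
  imports Defs
begin

section \<open>Coefficients of the power series of (1 - t)^(- q - 1)\<close>

definition conv_coeff :: "real \<Rightarrow> nat \<Rightarrow> real" where
  "conv_coeff q m = pochhammer (q + 1) m / fact m"

lemma conv_coeff_0 [simp]: "conv_coeff q 0 = 1"
  by (simp add: conv_coeff_def)

text \<open>Multiplying a power series by 1 - t takes backward differences of its coefficients, and
  (1 - t) * (1 - t)^(- q - 2) = (1 - t)^(- q - 1). In the proof every term becomes a multiple of
  \<open>pochhammer (q + 1 + 1) m / fact (Suc m)\<close>.\<close>

lemma conv_coeff_Suc_diff:
  "conv_coeff (q + 1) (Suc m) - conv_coeff (q + 1) m = conv_coeff q (Suc m)"
proof -
  have "pochhammer (q + 1) (Suc m) = (q + 1) * pochhammer (q + 1 + 1) m"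
    by (rule pochhammer_rec)
  moreover have "pochhammer (q + 1 + 1) (Suc m) = (q + 1 + 1 + real m) * pochhammer (q + 1 + 1) m"
    by (rule pochhammer_rec')
  moreover have "pochhammer (q + 1 + 1) m / fact m
      = (1 + real m) * pochhammer (q + 1 + 1) m / fact (Suc m)"
    by (simp add: divide_simps)
  ultimately show ?thesis
    unfolding conv_coeff_def by (simp add: diff_divide_distrib[symmetric] algebra_simps)
qed

text \<open>The weights of the difference of order \<alpha> are the coefficients of (1 -
  t)^\<alpha>, which is the case q = - 1 - \<alpha>.\<close>

lemma conv_coeff_gchoose: "conv_coeff (- 1 - \<alpha>) i = (-1) ^ i * (\<alpha> gchoose i)"
  by (simp add: conv_coeff_def gbinomial_pochhammer flip: power_mult_distrib)

text \<open>Away from the poles, \<open>pochhammer (q + 1) m\<close> is Gamma (q + 1 + m) / Gamma (q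
  + 1). The pochhammer form also makes sense at the poles, which are met at q = - 1 - \<alpha> for
  natural \<alpha>.\<close>

lemma rising_eq_conv_coeff:
  assumes "q + 1 \<notin> \<int>\<^sub>\<le>\<^sub>0"
  shows "rising (real m + 1) q / Gamma (q + 1) = conv_coeff q m"
proof -
  have "Gamma (real m + 1) = fact m"
    using Gamma_fact[of m] by (simp add: add.commute)
  then show ?thesis
    using pochhammer_Gamma[OF assms, of m]
    by (simp add: rising_def conv_coeff_def add_ac)
qed

section \<open>Composition of integer and Gruenwald-Letnikov differences\<close>

lemma nabla_0 [simp]: "nabla 0 z = z"
  by (auto simp: nabla_def)

lemma nabla_Suc: "nabla (Suc n) z k = nabla n z k - nabla n z (k - 1)"
proof -
  let ?g = "\<lambda>i. (-1) ^ i * z (k - real i)"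
  have "nabla (Suc n) z k = ?g 0 + (\<Sum>i\<le>n. real (Suc n choose Suc i) * ?g (Suc i))"
    unfolding nabla_def atLeast0AtMost sum.atMost_Suc_shift by (simp add: mult_ac)
  also have "\<dots> = (?g 0 + (\<Sum>i\<le>n. real (n choose Suc i) * ?g (Suc i)))
      + (\<Sum>i\<le>n. real (n choose i) * ?g (Suc i))"
    by (simp add: algebra_simps sum.distrib sum_subtractf sum_negf)
  also have "?g 0 + (\<Sum>i\<le>n. real (n choose Suc i) * ?g (Suc i))
      = (\<Sum>i\<le>Suc n. real (n choose i) * ?g i)"
    unfolding sum.atMost_Suc_shift by simp
  \<comment> \<open>The extra top term vanishes because \<open>n choose Suc n = 0\<close>.\<close>
  also have "\<dots> = nabla n z k"
    by (simp add: nabla_def atLeast0AtMost mult_ac)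
  also have "(\<Sum>i\<le>n. real (n choose i) * ?g (Suc i)) = - nabla n z (k - 1)"
    by (simp add: nabla_def atLeast0AtMost mult_ac sum_negf[symmetric] algebra_simps)
  finally show ?thesis by simp
qed

lemma nabla_nabla: "nabla m (nabla n z) = nabla (m + n) z"
  by (induction m) (simp_all add: fun_eq_iff nabla_Suc)

text \<open>Pascal's rule for \<open>gchoose\<close>. Below a + 1 all sums are empty, so differences
  that reach across a need no boundary terms. As k is any real, the last index N is a floor.\<close>

lemma gl_nabla_diff: "gl_nabla a \<beta> z k - gl_nabla a \<beta> z (k - 1) = gl_nabla a (\<beta> + 1) z k"
proof (cases "k < a + 1")
  case True
  have "{i. real i \<le> k - a - 1} = {}" "{i. real i \<le> k - 1 - a - 1} = {}"
    using True by auto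
  then show ?thesis
    by (simp add: gl_nabla_def)
next
  case False
  define t where "t = k - a - 1"
  define N where "N = nat \<lfloor>t\<rfloor>"
  have set_k: "{i. real i \<le> k - a - 1} = {..N}"
    using False unfolding N_def t_def[symmetric]
    by (auto simp: t_def le_nat_iff le_floor_iff simp del: floor_diff_one)
  have "real i \<le> k - 1 - a - 1 \<longleftrightarrow> real (Suc i) \<le> k - a - 1" for i
    by auto
  also have "real (Suc i) \<le> k - a - 1 \<longleftrightarrow> Suc i \<in> {..N}" for i
    using set_k by blast
  finally have set_k1: "{i. real i \<le> k - 1 - a - 1} = {..<N}"
    by (auto simp: Suc_le_eq)
  have shift: "(\<Sum>i\<le>N. h i) = h 0 + (\<Sum>i<N. h (Suc i))" for h :: "nat \<Rightarrow> real"
    by (rule sum.atMost_shift)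
  have pascal: "1 + \<beta> gchoose Suc i = (\<beta> gchoose i) + (\<beta> gchoose Suc i)" for i
    using gbinomial_Suc_Suc[of \<beta> i] by (simp add: add.commute)
  show ?thesis
    unfolding gl_nabla_def set_k set_k1 shift
    by (simp add: pascal algebra_simps sum.distrib sum_subtractf sum_negf)
qed

lemma nabla_gl_nabla: "nabla n (gl_nabla a \<beta> z) k = gl_nabla a (\<beta> + real n) z k"
proof (induction n arbitrary: k)
  case (Suc n)
  then show ?case
    using gl_nabla_diff[of a "\<beta> + real n" z k] by (simp add: nabla_Suc add_ac)
qed simp

lemma rl_nabla_eq_gl_nabla: "rl_nabla n a \<alpha> z k = gl_nabla a \<alpha> z k"
  by (simp add: rl_nabla_def nabla_gl_nabla)

section \<open>Convolution form and repeated summation by parts\<close>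

lemma gl_nabla_eq_conv:
  "gl_nabla a \<alpha> z (a + 1 + real m) = (\<Sum>j\<le>m. conv_coeff (- 1 - \<alpha>) (m - j) * z (a + 1 + real j))"
proof -
  have "{i. real i \<le> a + 1 + real m - a - 1} = {..m}"
    by auto
  then have "gl_nabla a \<alpha> z (a + 1 + real m)
      = (\<Sum>i\<le>m. conv_coeff (- 1 - \<alpha>) i * z (a + 1 + real m - real i))"
    by (simp add: gl_nabla_def conv_coeff_gchoose)
  also have "\<dots> = (\<Sum>j\<le>m. conv_coeff (- 1 - \<alpha>) (m - j) * z (a + 1 + real j))"
    by (rule sum.reindex_bij_witness[of _ "\<lambda>j. m - j" "\<lambda>i. m - i"]) (auto simp: of_nat_diff algebra_simps)
  finally show ?thesis .
qed

text \<open>All weights \<open>0 gchoose i\<close> with i > 0 vanish. This makes an integer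
  difference accessible to the expansion for fractional orders.\<close>

lemma gl_nabla_order_0: "gl_nabla a 0 z (a + 1 + real m) = z (a + 1 + real m)"
proof -
  have "{i. real i \<le> a + 1 + real m - a - 1} = {..m}"
    by auto
  then show ?thesis
    by (simp add: gl_nabla_def sum.atMost_shift)
qed

text \<open>Splitting off j = 0 leaves a sum of the same kind based at b + 1, hence the induction
  with b arbitrary. The two coefficients of z (b + 1) merge by
  \<open>conv_coeff_Suc_diff\<close>.\<close>

lemma conv_sum_by_parts:
  "(\<Sum>j\<le>m. conv_coeff q (m - j) * z (b + 1 + real j))
    = conv_coeff (q + 1) m * z b
      + (\<Sum>j\<le>m. conv_coeff (q + 1) (m - j) * (z (b + 1 + real j) - z (b + real j)))"
proof (induction m arbitrary: b)
  case 0
  then show ?case by simp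
next
  case (Suc m)
  have "b + 1 + 1 + real j = b + 1 + real (Suc j)" "b + 1 + real j = b + real (Suc j)" for j
    by simp_all
  then show ?case
    unfolding sum.atMost_Suc_shift using Suc.IH[of "b + 1"]
    by (simp add: conv_coeff_Suc_diff[of q m, symmetric] algebra_simps)
qed

text \<open>The parameter starts at - 1 - \<alpha> and each summation by parts raises it by one, so
  the i-th difference at a appears with i - \<alpha>. Natural \<alpha> are included, since
  \<open>conv_coeff\<close> has no poles.\<close>

lemma gl_nabla_taylor:
  "gl_nabla a \<alpha> z (a + 1 + real m)
    = (\<Sum>i\<le>K. conv_coeff (real i - \<alpha>) m * nabla i z a)
      + (\<Sum>j\<le>m. conv_coeff (real K - \<alpha>) (m - j) * nabla (Suc K) z (a + 1 + real j))"
proof (induction K)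
  case 0
  show ?case
    using conv_sum_by_parts[of "- 1 - \<alpha>" m z a] by (simp add: gl_nabla_eq_conv nabla_Suc)
next
  case (Suc K)
  show ?case
    using Suc.IH conv_sum_by_parts[of "real K - \<alpha>" m "nabla (Suc K) z" a]
    by (simp add: nabla_Suc[of "Suc K"] algebra_simps)
qed

text \<open>The expansion of \<open>nabla n z\<close> to depth K - n, reindexed by i + n. Taking
  \<beta> = 0 serves the integer differences and \<beta> = \<alpha> - n the Caputo ones.\<close>

lemma gl_nabla_nabla_taylor:
  assumes "n \<le> K"
  shows "gl_nabla a \<beta> (nabla n z) (a + 1 + real m)
    = (\<Sum>i=n..K. conv_coeff (real i - (\<beta> + real n)) m * nabla i z a)
      + (\<Sum>j\<le>m. conv_coeff (real K - (\<beta> + real n)) (m - j) * nabla (Suc K) z (a + 1 + real j))"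
proof -
  have "(\<Sum>i=n..K. conv_coeff (real i - (\<beta> + real n)) m * nabla i z a)
      = (\<Sum>i\<le>K - n. conv_coeff (real i - \<beta>) m * nabla (i + n) z a)"
    using assms
    by (intro sum.reindex_bij_witness[of _ "\<lambda>i. i + n" "\<lambda>i. i - n"]) (auto simp: algebra_simps of_nat_diff)
  moreover have "Suc (K - n) + n = Suc K" "real (K - n) - \<beta> = real K - (\<beta> + real n)"
    using assms by (auto simp: of_nat_diff)
  ultimately show ?thesis
    unfolding gl_nabla_taylor[of a \<beta> "nabla n z" m "K - n"] nabla_nabla by metis
qed

section \<open>Passage to grid sums, Gamma quotients and weights\<close>

lemma sum_nats_from:
  "(\<Sum>j | j \<in> nats_from b \<and> j \<le> b + real m. h j) = (\<Sum>j\<le>m. h (b + real j))"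
proof -
  have "{j. j \<in> nats_from b \<and> j \<le> b + real m} = (\<lambda>j. b + real j) ` {..m}"
    by (auto simp: nats_from_def)
  then show ?thesis
    by (simp add: sum.reindex inj_on_def)
qed

text \<open>A pole at - l would force \<alpha> = i + l + 1, a positive integer.\<close>

lemma order_shift_not_pole:
  assumes "\<nexists>m::nat. 1 \<le> m \<and> \<alpha> = real m"
  shows "real i - \<alpha> + 1 \<notin> \<int>\<^sub>\<le>\<^sub>0"
proof
  assume "real i - \<alpha> + 1 \<in> \<int>\<^sub>\<le>\<^sub>0"
  then obtain l where "real i - \<alpha> + 1 = - real l"
    by (auto elim!: nonpos_Ints_cases')
  then have "\<alpha> = real (i + l + 1)"
    by simp
  with assms show False
    by (metis le_add2)
qed

theorem theorem6:
  fixes a :: real and K :: nat and x w :: "real \<Rightarrow> real" and k :: real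
  assumes w_nonzero: "\<And>s. s \<in> nats_from (a - real K - 1) \<Longrightarrow> w s \<noteq> 0"
    and k_mem: "k \<in> nats_from (a + 1)"
  shows
    "(\<forall>n::nat. 1 \<le> n \<and> n < K \<longrightarrow>
        tempered (nabla n) w x k =
          (\<Sum>i=n..K. rising (k - a) (real i - real n) / fact (i - n)
              * (w a / w k) * tempered (nabla i) w x a)
          + (\<Sum>j | j \<in> nats_from (a + 1) \<and> j \<le> k.
              rising (k - j + 1) (real K - real n) / fact (K - n)
              * (w j / w k) * tempered (nabla (K + 1)) w x j)) \<and>
     (\<forall>\<alpha>::real. (\<nexists>m::nat. 1 \<le> m \<and> \<alpha> = real m) \<longrightarrow>
        tempered (gl_nabla a \<alpha>) w x k =
          (\<Sum>i=0..K. rising (k - a) (real i - \<alpha>) / Gamma (real i - \<alpha> + 1)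
              * (w a / w k) * tempered (nabla i) w x a)
          + (\<Sum>j | j \<in> nats_from (a + 1) \<and> j \<le> k.
              rising (k - j + 1) (real K - \<alpha>) / Gamma (real K - \<alpha> + 1)
              * (w j / w k) * tempered (nabla (K + 1)) w x j)) \<and>
     (\<forall>(n::nat) (\<alpha>::real). 1 \<le> n \<and> real n - 1 < \<alpha> \<and> \<alpha> < real n \<longrightarrow>
        tempered (rl_nabla n a \<alpha>) w x k =
          (\<Sum>i=0..K. rising (k - a) (real i - \<alpha>) / Gamma (real i - \<alpha> + 1)
              * (w a / w k) * tempered (nabla i) w x a)
          + (\<Sum>j | j \<in> nats_from (a + 1) \<and> j \<le> k.
              rising (k - j + 1) (real K - \<alpha>) / Gamma (real K - \<alpha> + 1)
              * (w j / w k) * tempered (nabla (K + 1)) w x j)) \<and>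
     (\<forall>(n::nat) (\<alpha>::real). 1 \<le> n \<and> real n - 1 < \<alpha> \<and> \<alpha> < real n \<and> n < K \<longrightarrow>
        tempered (caputo_nabla n a \<alpha>) w x k =
          (\<Sum>i=n..K. rising (k - a) (real i - \<alpha>) / Gamma (real i - \<alpha> + 1)
              * (w a / w k) * tempered (nabla i) w x a)
          + (\<Sum>j | j \<in> nats_from (a + 1) \<and> j \<le> k.
              rising (k - j + 1) (real K - \<alpha>) / Gamma (real K - \<alpha> + 1)
              * (w j / w k) * tempered (nabla (K + 1)) w x j))"
proof -
  define f where "f = (\<lambda>s. w s * x s)"
  obtain m where k: "k = a + 1 + real m"
    using k_mem by (auto simp: nats_from_def)
  \<comment> \<open>The grid starts at a - K - 1, so a + l is reached after l + K + 1 steps.\<close>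
  have w_ne: "w (a + real l) \<noteq> 0" for l
    by (rule w_nonzero) (auto simp: nats_from_def intro!: image_eqI[of _ _ "l + K + 1"])
  have wa: "w a \<noteq> 0"
    using w_ne[of 0] by simp
  have wj: "w (a + 1 + real l) \<noteq> 0" for l
    using w_ne[of "Suc l"] by (simp add: add_ac)
  \<comment> \<open>The step common to all four parts: the factors w a and w j cancel the inverse
    weights inside the tempered differences, leaving 1 / w k times an expansion of f. A and B stand
    for the Gamma or factorial coefficients.\<close>
  have expand:
    "tempered D w x k = (\<Sum>i=p..K. A i * (w a / w k) * tempered (nabla i) w x a)
      + (\<Sum>j | j \<in> nats_from (a + 1) \<and> j \<le> k. B j * (w j / w k) * tempered (nabla (K + 1)) w x j)"
    if D: "D f k = (\<Sum>i=p..K. conv_coeff (real i - \<alpha>) m * nabla i f a)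
        + (\<Sum>j\<le>m. conv_coeff (real K - \<alpha>) (m - j) * nabla (Suc K) f (a + 1 + real j))"
      and A: "\<And>i. i \<in> {p..K} \<Longrightarrow> A i = conv_coeff (real i - \<alpha>) m"
      and B: "\<And>j. j \<le> m \<Longrightarrow> B (a + 1 + real j) = conv_coeff (real K - \<alpha>) (m - j)"
    for D p \<alpha> A B
  proof -
    have "(\<Sum>i=p..K. A i * (w a / w k) * tempered (nabla i) w x a)
        = (1 / w k) * (\<Sum>i=p..K. conv_coeff (real i - \<alpha>) m * nabla i f a)"
      unfolding sum_distrib_left using wa
      by (intro sum.cong) (auto simp: A tempered_def f_def)
    moreover have "(\<Sum>j | j \<in> nats_from (a + 1) \<and> j \<le> k.
          B j * (w j / w k) * tempered (nabla (K + 1)) w x j)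
        = (1 / w k) *
          (\<Sum>j\<le>m. conv_coeff (real K - \<alpha>) (m - j) * nabla (Suc K) f (a + 1 + real j))"
      unfolding k sum_nats_from sum_distrib_left using wj
      by (intro sum.cong) (auto simp: B tempered_def f_def)
    moreover have "tempered D w x k = (1 / w k) * D f k"
      by (simp add: tempered_def f_def)
    ultimately show ?thesis
      by (simp add: D distrib_left)
  qed
  \<comment> \<open>Here k - a = m + 1, and at the point a + 1 + j the base of the rising function
    is (m - j) + 1; both have the form that \<open>rising_eq_conv_coeff\<close> needs.\<close>
  have coeff_a: "rising (k - a) q / Gamma (q + 1) = conv_coeff q m"
    if "q + 1 \<notin> \<int>\<^sub>\<le>\<^sub>0" for q
    using rising_eq_conv_coeff[OF that, of m] by (simp add: k add_ac)
  have coeff_j: "rising (k - (a + 1 + real j) + 1) q / Gamma (q + 1) = conv_coeff q (m - j)"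
    if "q + 1 \<notin> \<int>\<^sub>\<le>\<^sub>0" "j \<le> m" for q j
    using rising_eq_conv_coeff[OF that(1), of "m - j"] that(2) by (simp add: k of_nat_diff)
  have nonint: "\<nexists>m::nat. 1 \<le> m \<and> \<alpha> = real m" if "real n - 1 < \<alpha>" "\<alpha> < real n" for n \<alpha>
  proof
    assume "\<exists>m::nat. 1 \<le> m \<and> \<alpha> = real m"
    then obtain l where "\<alpha> = real l" by blast
    with that have "n < l + 1" "l < n" by linarith+
    then show False by simp
  qed
  show ?thesis
  proof (intro conjI allI impI; (elim conjE)?)
    fix n :: nat
    assume n: "1 \<le> n" "n < K"
    \<comment> \<open>The order n is a positive integer, so \<open>order_shift_not_pole\<close> does
      not apply; poles are avoided because the sum starts at i = n.\<close>
    have fact_Gamma: "fact (i - n) = Gamma (real i - real n + 1)"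
      and not_pole: "real i - real n + 1 \<notin> \<int>\<^sub>\<le>\<^sub>0" if "n \<le> i" for i
      using that Gamma_fact[of "i - n", where 'a = real]
      by (auto simp: of_nat_diff add_ac elim!: nonpos_Ints_cases')
    show "tempered (nabla n) w x k =
          (\<Sum>i=n..K. rising (k - a) (real i - real n) / fact (i - n)
              * (w a / w k) * tempered (nabla i) w x a)
          + (\<Sum>j | j \<in> nats_from (a + 1) \<and> j \<le> k.
              rising (k - j + 1) (real K - real n) / fact (K - n)
              * (w j / w k) * tempered (nabla (K + 1)) w x j)"
    proof (rule expand)
      show "nabla n f k = (\<Sum>i=n..K. conv_coeff (real i - real n) m * nabla i f a)
        + (\<Sum>j\<le>m. conv_coeff (real K - real n) (m - j) * nabla (Suc K) f (a + 1 + real j))"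
        \<comment> \<open>At k, which lies above a, the difference of order 0 of
          \<open>nabla n f\<close> is \<open>nabla n f\<close> itself.\<close>
        using gl_nabla_nabla_taylor[of n K a 0 f m] n
        by (simp add: gl_nabla_order_0 k)
      show "rising (k - a) (real i - real n) / fact (i - n) = conv_coeff (real i - real n) m"
        if "i \<in> {n..K}" for i
        using that coeff_a[OF not_pole, of i] by (simp add: fact_Gamma)
      show "rising (k - (a + 1 + real j) + 1) (real K - real n) / fact (K - n)
          = conv_coeff (real K - real n) (m - j)" if "j \<le> m" for j
        using that n coeff_j[OF not_pole, of K j] by (simp add: fact_Gamma)
    qed
  next
    fix \<alpha> :: real
    assume \<alpha>: "\<nexists>m::nat. 1 \<le> m \<and> \<alpha> = real m"
    note not_pole = order_shift_not_pole[OF \<alpha>]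
    show "tempered (gl_nabla a \<alpha>) w x k =
          (\<Sum>i=0..K. rising (k - a) (real i - \<alpha>) / Gamma (real i - \<alpha> + 1)
              * (w a / w k) * tempered (nabla i) w x a)
          + (\<Sum>j | j \<in> nats_from (a + 1) \<and> j \<le> k.
              rising (k - j + 1) (real K - \<alpha>) / Gamma (real K - \<alpha> + 1)
              * (w j / w k) * tempered (nabla (K + 1)) w x j)"
      by (rule expand)
        (simp_all only: k gl_nabla_taylor atLeast0AtMost coeff_a[OF not_pole, unfolded k]
          coeff_j[OF not_pole, unfolded k])
  next
    fix n :: nat and \<alpha> :: real
    assume n: "1 \<le> n" "real n - 1 < \<alpha>" "\<alpha> < real n"
    note not_pole = order_shift_not_pole[OF nonint[OF n(2,3)]]
    show "tempered (rl_nabla n a \<alpha>) w x k =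
          (\<Sum>i=0..K. rising (k - a) (real i - \<alpha>) / Gamma (real i - \<alpha> + 1)
              * (w a / w k) * tempered (nabla i) w x a)
          + (\<Sum>j | j \<in> nats_from (a + 1) \<and> j \<le> k.
              rising (k - j + 1) (real K - \<alpha>) / Gamma (real K - \<alpha> + 1)
              * (w j / w k) * tempered (nabla (K + 1)) w x j)"
      by (rule expand)
        (simp_all only: k rl_nabla_eq_gl_nabla gl_nabla_taylor atLeast0AtMost
          coeff_a[OF not_pole, unfolded k] coeff_j[OF not_pole, unfolded k])
  next
    fix n :: nat and \<alpha> :: real
    assume n: "1 \<le> n" "real n - 1 < \<alpha>" "\<alpha> < real n" "n < K"
    note not_pole = order_shift_not_pole[OF nonint[OF n(2,3)]]
    show "tempered (caputo_nabla n a \<alpha>) w x k =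
          (\<Sum>i=n..K. rising (k - a) (real i - \<alpha>) / Gamma (real i - \<alpha> + 1)
              * (w a / w k) * tempered (nabla i) w x a)
          + (\<Sum>j | j \<in> nats_from (a + 1) \<and> j \<le> k.
              rising (k - j + 1) (real K - \<alpha>) / Gamma (real K - \<alpha> + 1)
              * (w j / w k) * tempered (nabla (K + 1)) w x j)"
    proof (rule expand)
      show "caputo_nabla n a \<alpha> f k = (\<Sum>i=n..K. conv_coeff (real i - \<alpha>) m * nabla i f a)
        + (\<Sum>j\<le>m. conv_coeff (real K - \<alpha>) (m - j) * nabla (Suc K) f (a + 1 + real j))"
        using gl_nabla_nabla_taylor[of n K a "\<alpha> - real n" f m] n
        by (simp add: caputo_nabla_def k)
    qed (simp_all only: coeff_a[OF not_pole] coeff_j[OF not_pole])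
  qed
qed

end
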